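(* For every integer $\ell\ge 1$, the function $$S(x)=\left(1+\frac{1}{3x-\Omega(x)}\right)^{2x+1}$$ is completely monotonic on $I_\ell$. That is, on $I_\ell$ (where $\Omega$ has the constant value $\ell-1$) the function $f_\ell(x)=\left(1+\frac{1}{3x-(\ell-1)}\right)^{2x+1}$ satisfies $(-1)^n f_\ell^{(n)}(x)\ge 0$ for all $x\in I_\ell$ and all integers $n\ge 0$.
   Context: For real $x>0$ let $$\Omega(x)=\left\lceil 3x-\frac{1}{2^{1/(2x+1)}-1}\right\rceil ,$$ where $\lceil y\rceil$ is the smallest integer greater than or equal to $y$; this is an integer-valued step function. For each integer $\ell\ge 1$, $I_\ell=\{x\in\mathbb{R}: x>0,\ \Omega(x)=\ell-1\}$. A function $f$ on a real interval $I$ is completely monotonic on $I$ if it has derivatives of all orders on $I$ and $(-1)^n f^{(n)}(x)\ge 0$ for all $x\in I$ and all $n\ge 0$. At an endpoint of $I_\ell$ belonging to $I_\ell$, derivatives are those of the expression $f_\ell$, which is smooth in a neighbourhood of that point. *)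

theory Defs
  imports "HOL-Analysis.Analysis"
begin

definition Omega :: "real \<Rightarrow> int" where
  "Omega x = \<lceil>3 * x - 1 / (2 powr (1 / (2 * x + 1)) - 1)\<rceil>"

definition Iset :: "int \<Rightarrow> real set" where
  "Iset l = {x. x > 0 \<and> Omega x = l - 1}"

definition S_fun :: "real \<Rightarrow> real" where
  "S_fun x = (1 + 1 / (3 * x - real_of_int (Omega x))) powr (2 * x + 1)"

definition f_ell :: "int \<Rightarrow> real \<Rightarrow> real" where
  "f_ell l x = (1 + 1 / (3 * x - (real_of_int l - 1))) powr (2 * x + 1)"

(* D n is the n-th derivative of g on I. Derivatives are taken within I, so they
   are one-sided at an endpoint of I that belongs to I, and the values of g outside I
   play no role. On an interval with more than one point D n is unique on I. *)
definition completely_monotonic_on :: "real set \<Rightarrow> (real \<Rightarrow> real) \<Rightarrow> bool" where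
  "completely_monotonic_on I g \<longleftrightarrow>
     is_interval I \<and>
     (\<exists>D :: nat \<Rightarrow> real \<Rightarrow> real.
        (\<forall>x\<in>I. D 0 x = g x) \<and>
        (\<forall>n. \<forall>x\<in>I. (D n has_real_derivative D (Suc n) x) (at x within I)) \<and>
        (\<forall>n. \<forall>x\<in>I. (-1) ^ n * D n x \<ge> 0))"

end

theory Submission
  imports Defs
begin

text \<open>
  On \<open>Iset l\<close> put \<open>t = 3 * x - (l - 1)\<close>. The exponent becomes
  \<open>2 * x + 1 = 2/3 * (t + c)\<close> with \<open>c = l + 1/2\<close>, so that
  \<open>f_ell l x = exp (2/3 * ((t + c) * ln (1 + 1/t)))\<close>. Two observations give the theorem.

  Firstly, \<open>t > 0\<close> on \<open>Iset l\<close>: the ceiling exceeds its argument by less than one, hence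
  \<open>t > 1 / (2 powr (1 / (2 * x + 1)) - 1) - 1\<close>, and the right-hand side is positive because
  \<open>2 powr s < 2\<close> for \<open>s < 1\<close>.

  Secondly, \<open>(t + c) * ln (1 + 1/t)\<close> is completely monotonic on \<open>t > 0\<close> as soon as \<open>c \<ge> 1\<close>.
  It is the sum of \<open>(c - 1) * ln (1 + 1/t)\<close> and \<open>(t + 1) * ln (1 + 1/t)\<close>, and differentiating
  reduces both to reciprocals: minus the derivative of \<open>ln (1 + 1/t)\<close> is \<open>1/t * 1/(t + 1)\<close>,
  minus the derivative of \<open>(t + 1) * ln (1 + 1/t)\<close> is \<open>1/t - ln (1 + 1/t)\<close>, and minus the
  derivative of the latter is \<open>(1/t)\<^sup>2 * 1/(t + 1)\<close>. The exponential of a completely monotonic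
  function is completely monotonic, as \<open>- (exp g)' = (- g') * exp g\<close>.

  That \<open>Iset l\<close> is an interval follows from the monotonicity of
  \<open>3 * x - 1 / (2 powr (1 / (2 * x + 1)) - 1)\<close>. With \<open>u = ln 2 / (2 * x + 1)\<close>, the derivative
  of the subtracted term is \<open>2 / ln 2 * (u/2 / sinh (u/2))\<^sup>2 \<le> 2 / ln 2\<close>, and
  \<open>2 / ln 2 \<le> 3\<close> because \<open>ln 2 \<ge> 2/3\<close>.
\<close>

section \<open>Functions with derivatives of alternating sign\<close>

text \<open>
  Complete monotonicity is cut off at order \<open>n\<close> and phrased recursively through \<open>- f'\<close>. Closure
  under products and exponentials then needs only the first-order rules and induction on \<open>n\<close>,
  in place of the Leibniz and Faa di Bruno formulas for higher derivatives.
\<close>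

fun alternating_derivs :: "nat \<Rightarrow> real set \<Rightarrow> (real \<Rightarrow> real) \<Rightarrow> bool" where
  "alternating_derivs 0 U f \<longleftrightarrow> (\<forall>x\<in>U. f x \<ge> 0)"
| "alternating_derivs (Suc n) U f \<longleftrightarrow> (\<forall>x\<in>U. f x \<ge> 0) \<and>
     (\<exists>f'. (\<forall>x\<in>U. (f has_real_derivative f' x) (at x)) \<and> alternating_derivs n U (\<lambda>x. - f' x))"

lemma alternating_derivs_nonneg: "alternating_derivs n U f \<Longrightarrow> x \<in> U \<Longrightarrow> f x \<ge> 0"
  by (cases n) auto

lemma alternating_derivs_SucI:
  assumes "\<And>x. x \<in> U \<Longrightarrow> f x \<ge> 0"
    and "\<And>x. x \<in> U \<Longrightarrow> (f has_real_derivative - d x) (at x)"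
    and "alternating_derivs n U d"
  shows "alternating_derivs (Suc n) U f"
  unfolding alternating_derivs.simps
  using assms by (intro conjI exI[of _ "\<lambda>x. - d x"]) auto

lemma alternating_derivs_SucE:
  assumes "alternating_derivs (Suc n) U f"
  obtains d where "\<And>x. x \<in> U \<Longrightarrow> (f has_real_derivative - d x) (at x)"
    and "alternating_derivs n U d"
proof -
  obtain f' where "\<forall>x\<in>U. (f has_real_derivative f' x) (at x)"
    and "alternating_derivs n U (\<lambda>x. - f' x)"
    using assms by auto
  then show ?thesis using that[of "\<lambda>x. - f' x"] by auto
qed

lemma alternating_derivs_SucD: "alternating_derivs (Suc n) U f \<Longrightarrow> alternating_derivs n U f"
proof (induction n arbitrary: f)
  case 0
  then show ?case by simp
next
  case (Suc n)
  obtain d where "\<And>x. x \<in> U \<Longrightarrow> (f has_real_derivative - d x) (at x)"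
    and "alternating_derivs (Suc n) U d"
    using Suc.prems by (rule alternating_derivs_SucE) blast
  with Suc show ?case
    by (intro alternating_derivs_SucI[where d = d]) (auto intro: alternating_derivs_nonneg)
qed

lemma alternating_derivs_cong:
  assumes "alternating_derivs n U f" "open U" "\<And>x. x \<in> U \<Longrightarrow> f x = g x"
  shows "alternating_derivs n U g"
proof (cases n)
  case 0
  with assms show ?thesis by auto
next
  case (Suc k)
  obtain d where d: "\<And>x. x \<in> U \<Longrightarrow> (f has_real_derivative - d x) (at x)"
    and "alternating_derivs k U d"
    using assms(1) unfolding Suc by (rule alternating_derivs_SucE) blast
  moreover have "(g has_real_derivative - d x) (at x)" if "x \<in> U" for x
    using d[OF that] by (rule has_field_derivative_transform_within_open) (use assms that in auto)
  moreover have "g x \<ge> 0" if "x \<in> U" for x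
    using assms(3)[OF that] alternating_derivs_nonneg[OF assms(1) that] by simp
  ultimately show ?thesis
    unfolding Suc by (intro alternating_derivs_SucI)
qed

lemma alternating_derivs_add:
  "alternating_derivs n U f \<Longrightarrow> alternating_derivs n U g \<Longrightarrow> alternating_derivs n U (\<lambda>x. f x + g x)"
proof (induction n arbitrary: f g)
  case 0
  then show ?case by auto
next
  case (Suc n)
  obtain df where "\<And>x. x \<in> U \<Longrightarrow> (f has_real_derivative - df x) (at x)"
    and "alternating_derivs n U df"
    using Suc.prems(1) by (rule alternating_derivs_SucE) blast
  moreover obtain dg where "\<And>x. x \<in> U \<Longrightarrow> (g has_real_derivative - dg x) (at x)"
    and "alternating_derivs n U dg"
    using Suc.prems(2) by (rule alternating_derivs_SucE) blast
  ultimately show ?case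
    using Suc.prems Suc.IH
    by (intro alternating_derivs_SucI[where d = "\<lambda>x. df x + dg x"])
       (auto intro!: derivative_eq_intros add_nonneg_nonneg alternating_derivs_nonneg)
qed

lemma alternating_derivs_mult:
  "alternating_derivs n U f \<Longrightarrow> alternating_derivs n U g \<Longrightarrow> alternating_derivs n U (\<lambda>x. f x * g x)"
proof (induction n arbitrary: f g)
  case 0
  then show ?case by auto
next
  case (Suc n)
  obtain df where df: "\<And>x. x \<in> U \<Longrightarrow> (f has_real_derivative - df x) (at x)"
    and adf: "alternating_derivs n U df"
    using Suc.prems(1) by (rule alternating_derivs_SucE) blast
  obtain dg where dg: "\<And>x. x \<in> U \<Longrightarrow> (g has_real_derivative - dg x) (at x)"
    and adg: "alternating_derivs n U dg"
    using Suc.prems(2) by (rule alternating_derivs_SucE) blast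
  show ?case
  proof (rule alternating_derivs_SucI)
    show "f x * g x \<ge> 0" if "x \<in> U" for x
      using Suc.prems that by (auto intro!: mult_nonneg_nonneg alternating_derivs_nonneg)
    show "((\<lambda>x. f x * g x) has_real_derivative - (df x * g x + f x * dg x)) (at x)"
      if "x \<in> U" for x
      using df[OF that] dg[OF that] by (auto intro!: derivative_eq_intros)
    show "alternating_derivs n U (\<lambda>x. df x * g x + f x * dg x)"
      using Suc.prems[THEN alternating_derivs_SucD] adf adg
      by (intro alternating_derivs_add Suc.IH)
  qed
qed

lemma alternating_derivs_const: "c \<ge> 0 \<Longrightarrow> alternating_derivs n U (\<lambda>x. c)"
proof (induction n arbitrary: c)
  case 0
  then show ?case by simp
next
  case (Suc n)
  then show ?case
    by (intro alternating_derivs_SucI[where d = "\<lambda>x. 0"]) auto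
qed

text \<open>
  The induction is on the order: minus the derivative of \<open>exp (g x)\<close> is a product with
  \<open>exp (g x)\<close> itself as a factor, which is known to order \<open>n\<close> by the induction hypothesis.
\<close>

lemma alternating_derivs_exp:
  "alternating_derivs n U g \<Longrightarrow> alternating_derivs n U (\<lambda>x. exp (g x))"
proof (induction n)
  case 0
  then show ?case by auto
next
  case (Suc n)
  obtain d where d: "\<And>x. x \<in> U \<Longrightarrow> (g has_real_derivative - d x) (at x)"
    and ad: "alternating_derivs n U d"
    using Suc.prems by (rule alternating_derivs_SucE) blast
  have "alternating_derivs n U (\<lambda>x. d x * exp (g x))"
    using ad Suc.IH[OF alternating_derivs_SucD[OF Suc.prems]] by (rule alternating_derivs_mult)
  then show ?case
    using d by (intro alternating_derivs_SucI[where d = "\<lambda>x. d x * exp (g x)"])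
      (auto intro!: derivative_eq_intros)
qed

lemma alternating_derivs_affine:
  assumes "p \<ge> 0" "\<And>x. x \<in> U \<Longrightarrow> p * x + q \<in> V"
  shows "alternating_derivs n V f \<Longrightarrow> alternating_derivs n U (\<lambda>x. f (p * x + q))"
proof (induction n arbitrary: f)
  case 0
  then show ?case using assms by auto
next
  case (Suc n)
  obtain d where d: "\<And>x. x \<in> V \<Longrightarrow> (f has_real_derivative - d x) (at x)"
    and ad: "alternating_derivs n V d"
    using Suc.prems by (rule alternating_derivs_SucE) blast
  show ?case
  proof (rule alternating_derivs_SucI)
    show "f (p * x + q) \<ge> 0" if "x \<in> U" for x
      using alternating_derivs_nonneg[OF Suc.prems assms(2)[OF that]] .
    show "((\<lambda>x. f (p * x + q)) has_real_derivative - (p * d (p * x + q))) (at x)"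
      if "x \<in> U" for x
    proof -
      have "((\<lambda>x. p * x + q) has_real_derivative p) (at x)"
        by (auto intro!: derivative_eq_intros)
      with d[OF assms(2)[OF that]]
      have "((\<lambda>x. f (p * x + q)) has_real_derivative - d (p * x + q) * p) (at x)"
        by (rule DERIV_chain2)
      then show ?thesis by (simp add: mult.commute)
    qed
    show "alternating_derivs n U (\<lambda>x. p * d (p * x + q))"
      using ad assms(1) by (intro alternating_derivs_mult alternating_derivs_const Suc.IH)
  qed
qed

text \<open>
  This lemma leads back from the recursive notion to iterated derivatives: on an open set the
  witness for the first derivative must be \<open>deriv f\<close>, so the recursion passes to
  \<open>- deriv f\<close>, \<open>deriv (deriv f)\<close>, and so on, at the cost of one order each time.
\<close>

lemma alternating_derivs_higher_deriv:
  assumes "open U" "\<And>n. alternating_derivs n U f"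
  shows "alternating_derivs n U (\<lambda>x. (-1) ^ k * (deriv ^^ k) f x)"
    and "x \<in> U \<Longrightarrow> (deriv ^^ k) f field_differentiable (at x)"
proof -
  define h where "h k x = (-1) ^ k * (deriv ^^ k) f x" for k x
  have step: "alternating_derivs n U (h (Suc k)) \<and>
      (\<forall>x\<in>U. (deriv ^^ k) f field_differentiable (at x))"
    if "alternating_derivs (Suc n) U (h k)" for n k
  proof -
    obtain d where d: "\<And>x. x \<in> U \<Longrightarrow> (h k has_real_derivative - d x) (at x)"
      and ad: "alternating_derivs n U d"
      using \<open>alternating_derivs (Suc n) U (h k)\<close> by (rule alternating_derivs_SucE) blast
    have D: "((deriv ^^ k) f has_real_derivative (-1) ^ Suc k * d x) (at x)" if "x \<in> U" for x
    proof -
      have "((\<lambda>y. (-1) ^ k * h k y) has_real_derivative (-1) ^ k * - d x) (at x)"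
        by (intro DERIV_cmult d that)
      moreover have "(\<lambda>y. (-1) ^ k * h k y) = (deriv ^^ k) f"
        by (auto simp: h_def simp flip: mult.assoc power_add mult_2)
      ultimately show ?thesis by simp
    qed
    have "d x = h (Suc k) x" if "x \<in> U" for x
      using DERIV_imp_deriv[OF D[OF that]] by (simp add: h_def flip: mult.assoc power_add mult_2)
    with ad D \<open>open U\<close> show ?thesis
      by (auto intro: alternating_derivs_cong simp: field_differentiable_def)
  qed
  have "alternating_derivs n U (h k)" for n
  proof (induction k arbitrary: n)
    case 0
    have "h 0 = f" by (simp add: h_def fun_eq_iff)
    then show ?case using assms(2) by simp
  next
    case (Suc k)
    then show ?case using step by blast
  qed
  then show "alternating_derivs n U (\<lambda>x. (-1) ^ k * (deriv ^^ k) f x)"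
    and "x \<in> U \<Longrightarrow> (deriv ^^ k) f field_differentiable (at x)"
    using step unfolding h_def[abs_def] by blast+
qed

section \<open>The function \<open>(t + c) * ln (1 + 1/t)\<close>\<close>

text \<open>Minus the derivative of \<open>1 / t\<close> is its own square, so closure under products suffices.\<close>

lemma alternating_derivs_inverse: "alternating_derivs n {0<..} (\<lambda>t. 1 / t)"
proof (induction n)
  case 0
  then show ?case by simp
next
  case (Suc n)
  have "alternating_derivs n {0<..} (\<lambda>t. 1 / t * (1 / t))"
    using Suc by (intro alternating_derivs_mult)
  then show ?case
    by (rule alternating_derivs_SucI[rotated 2])
       (auto intro!: derivative_eq_intros simp: power2_eq_square)
qed

lemma alternating_derivs_inverse_Suc: "alternating_derivs n {0<..} (\<lambda>t. 1 / (t + 1))"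
  using alternating_derivs_affine[of 1 "{0<..}" 1 "{0<..}" n "\<lambda>t. 1 / t"]
    alternating_derivs_inverse by simp

lemma DERIV_ln_one_plus_inverse:
  fixes t :: real
  assumes "t > 0"
  shows "((\<lambda>t. ln (1 + 1 / t)) has_real_derivative - (1 / t * (1 / (t + 1)))) (at t)"
proof -
  have "1 + 1 / t > 0" using assms by (simp add: add_pos_pos)
  then have "((\<lambda>t. ln (1 + 1 / t)) has_real_derivative 1 / (1 + 1 / t) * (- 1 / t\<^sup>2)) (at t)"
    using assms by (auto intro!: derivative_eq_intros simp: power2_eq_square)
  moreover have "1 / (1 + 1 / t) * (- 1 / t\<^sup>2) = - (1 / t * (1 / (t + 1)))"
    using assms by (simp add: power2_eq_square divide_simps)
  ultimately show ?thesis by simp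
qed

lemma alternating_derivs_ln:
  "alternating_derivs n {0<..} (\<lambda>t. ln (1 + 1 / t))"
proof (rule alternating_derivs_SucD, rule alternating_derivs_SucI)
  show "((\<lambda>t. ln (1 + 1 / t)) has_real_derivative - (1 / t * (1 / (t + 1)))) (at t)"
    if "t \<in> {0<..}" for t :: real
    using that by (intro DERIV_ln_one_plus_inverse) simp
  show "alternating_derivs n {0<..} (\<lambda>t. 1 / t * (1 / (t + 1)))"
    by (intro alternating_derivs_mult alternating_derivs_inverse alternating_derivs_inverse_Suc)
qed auto

lemma alternating_derivs_inverse_minus_ln:
  "alternating_derivs n {0<..} (\<lambda>t. 1 / t - ln (1 + 1 / t))"
proof (rule alternating_derivs_SucD, rule alternating_derivs_SucI)
  show "1 / t - ln (1 + 1 / t) \<ge> 0" if "t \<in> {0<..}" for t :: real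
    using ln_add_one_self_le_self[of "1 / t"] that by simp
  show "((\<lambda>t. 1 / t - ln (1 + 1 / t)) has_real_derivative - (1 / t * (1 / t) * (1 / (t + 1)))) (at t)"
    if "t \<in> {0<..}" for t :: real
  proof -
    have "t > 0" using that by simp
    then have "((\<lambda>t. 1 / t - ln (1 + 1 / t)) has_real_derivative
        - 1 / t\<^sup>2 - - (1 / t * (1 / (t + 1)))) (at t)"
      by (intro DERIV_diff DERIV_ln_one_plus_inverse)
         (auto intro!: derivative_eq_intros simp: power2_eq_square)
    moreover have "- 1 / t\<^sup>2 - - (1 / t * (1 / (t + 1))) = - (1 / t * (1 / t) * (1 / (t + 1)))"
      using \<open>t > 0\<close> by (simp add: power2_eq_square divide_simps)
    ultimately show ?thesis by simp
  qed
  show "alternating_derivs n {0<..} (\<lambda>t. 1 / t * (1 / t) * (1 / (t + 1)))"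
    by (intro alternating_derivs_mult alternating_derivs_inverse alternating_derivs_inverse_Suc)
qed

lemma alternating_derivs_Suc_times_ln:
  "alternating_derivs n {0<..} (\<lambda>t. (t + 1) * ln (1 + 1 / t))"
proof (rule alternating_derivs_SucD, rule alternating_derivs_SucI)
  show "((\<lambda>t. (t + 1) * ln (1 + 1 / t)) has_real_derivative - (1 / t - ln (1 + 1 / t))) (at t)"
    if "t \<in> {0<..}" for t :: real
  proof -
    have "t > 0" using that by simp
    then have "((\<lambda>t. (t + 1) * ln (1 + 1 / t)) has_real_derivative
        1 * ln (1 + 1 / t) + - (1 / t * (1 / (t + 1))) * (t + 1)) (at t)"
      by (intro DERIV_mult DERIV_ln_one_plus_inverse) (auto intro!: derivative_eq_intros)
    then show ?thesis using \<open>t > 0\<close> by simp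
  qed
  show "alternating_derivs n {0<..} (\<lambda>t. 1 / t - ln (1 + 1 / t))"
    by (rule alternating_derivs_inverse_minus_ln)
qed auto

text \<open>
  For \<open>c = 1\<close> the second derivative of \<open>(t + c) * ln (1 + 1/t)\<close> is a plain product of reciprocals;
  a larger \<open>c\<close> adds a nonnegative multiple of \<open>ln (1 + 1/t)\<close>.
\<close>

lemma alternating_derivs_shift_times_ln:
  assumes "c \<ge> 1"
  shows "alternating_derivs n {0<..} (\<lambda>t. (t + c) * ln (1 + 1 / t))"
proof -
  have "alternating_derivs n {0<..} (\<lambda>t. (c - 1) * ln (1 + 1 / t) + (t + 1) * ln (1 + 1 / t))"
    using assms
    by (intro alternating_derivs_add alternating_derivs_mult alternating_derivs_const
        alternating_derivs_ln alternating_derivs_Suc_times_ln) simp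
  then show ?thesis by (simp add: algebra_simps)
qed

lemma alternating_derivs_f_ell:
  assumes "l \<ge> 1"
  shows "alternating_derivs n {x. 3 * x - (real_of_int l - 1) > 0} (f_ell l)"
proof -
  let ?U = "{x. 3 * x - (real_of_int l - 1) > 0}"
  define c where "c = real_of_int l + 1 / 2"
  define t where "t x = 3 * x + - (real_of_int l - 1)" for x
  have "c \<ge> 1" using assms by (simp add: c_def)
  have "open ?U" by (intro open_Collect_less continuous_intros)
  have "alternating_derivs n ?U (\<lambda>x. (t x + c) * ln (1 + 1 / t x))"
    unfolding t_def
    by (rule alternating_derivs_affine[OF _ _ alternating_derivs_shift_times_ln[OF \<open>c \<ge> 1\<close>]]) auto
  then have "alternating_derivs n ?U (\<lambda>x. exp (2 / 3 * ((t x + c) * ln (1 + 1 / t x))))"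
    by (intro alternating_derivs_exp alternating_derivs_mult[OF alternating_derivs_const]) auto
  then show ?thesis
  proof (rule alternating_derivs_cong[OF _ \<open>open ?U\<close>])
    fix x assume "x \<in> ?U"
    then have "t x > 0" by (simp add: t_def)
    then have "1 + 1 / t x > 0" by (simp add: add_pos_pos)
    have "exp (2 / 3 * ((t x + c) * ln (1 + 1 / t x))) = exp ((2 / 3 * (t x + c)) * ln (1 + 1 / t x))"
      by (simp only: mult.assoc)
    also have "2 / 3 * (t x + c) = 2 * x + 1"
      by (simp add: t_def c_def)
    also have "exp ((2 * x + 1) * ln (1 + 1 / t x)) = (1 + 1 / t x) powr (2 * x + 1)"
      using \<open>1 + 1 / t x > 0\<close> by (simp add: powr_def)
    also have "\<dots> = f_ell l x"
      unfolding f_ell_def t_def by (simp only: diff_conv_add_uminus)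
    finally show "exp (2 / 3 * ((t x + c) * ln (1 + 1 / t x))) = f_ell l x" .
  qed
qed

section \<open>The set \<open>Iset l\<close>\<close>

text \<open>
  The quantity \<open>1 / (2 powr s - 1)\<close> exceeds \<open>1\<close> for \<open>0 < s < 1\<close>, which makes up for the gap of
  less than one between the ceiling and its argument.
\<close>

lemma Iset_subset: "Iset l \<subseteq> {x. 3 * x - (real_of_int l - 1) > 0}"
proof
  fix x assume "x \<in> Iset l"
  then have "x > 0" and Om: "Omega x = l - 1" by (auto simp: Iset_def)
  define b where "b = 2 powr (1 / (2 * x + 1))"
  have "1 < b" using \<open>x > 0\<close> by (auto simp: b_def)
  moreover have "b < 2 powr 1"
    unfolding b_def using \<open>x > 0\<close> by (intro powr_less_mono) auto
  ultimately have "1 / (b - 1) > 1" by (simp add: divide_simps)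
  moreover have "real_of_int l - 1 < 3 * x - 1 / (b - 1) + 1"
    using Om unfolding Omega_def b_def by linarith
  ultimately show "x \<in> {x. 3 * x - (real_of_int l - 1) > 0}" by simp
qed

text \<open>This is the inequality \<open>v \<le> sinh v\<close> at \<open>v = u / 2\<close>, squared and multiplied by \<open>4 * exp u\<close>.\<close>

lemma square_times_exp_le:
  fixes u :: real
  assumes "u \<ge> 0"
  shows "u\<^sup>2 * exp u \<le> (exp u - 1)\<^sup>2"
proof -
  have "u / 2 \<le> (exp (u / 2) - inverse (exp (u / 2))) / 2"
    using assms by (intro real_le_x_sinh) auto
  then have "u * exp (u / 2) \<le> (exp (u / 2) - inverse (exp (u / 2))) * exp (u / 2)"
    by (intro mult_right_mono) auto
  also have "\<dots> = exp (u / 2) * exp (u / 2) - 1"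
    by (simp add: algebra_simps)
  also have "exp (u / 2) * exp (u / 2) = exp u"
    by (simp flip: exp_add)
  finally have "(u * exp (u / 2))\<^sup>2 \<le> (exp u - 1)\<^sup>2"
    using assms by (intro power_mono) auto
  moreover have "(u * exp (u / 2))\<^sup>2 = u\<^sup>2 * exp u"
    by (simp add: power_mult_distrib power2_eq_square flip: exp_add)
  ultimately show ?thesis by simp
qed

text \<open>
  The term \<open>1 / (2 powr (1 / (2 * x + 1)) - 1)\<close> grows at a rate of at most \<open>2 / ln 2\<close>, which is
  about \<open>2.885\<close>: only just slower than \<open>3 * x\<close>.
\<close>

lemma Omega_argument_mono:
  fixes x y :: real
  assumes "0 < x" "x \<le> y"
  shows "3 * x - 1 / (2 powr (1 / (2 * x + 1)) - 1) \<le> 3 * y - 1 / (2 powr (1 / (2 * y + 1)) - 1)"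
proof (rule DERIV_nonneg_imp_nondecreasing[OF \<open>x \<le> y\<close>])
  fix z assume "x \<le> z" "z \<le> y"
  with assms have "z > 0" by simp
  define u where "u = ln 2 / (2 * z + 1)"
  have "u > 0" using \<open>z > 0\<close> by (simp add: u_def)
  have "exp u > 1" using \<open>u > 0\<close> by simp
  define D where "D = 3 - 2 / ln 2 * (u\<^sup>2 * exp u / (exp u - 1)\<^sup>2)"
  have "((\<lambda>z. ln 2 / (2 * z + 1)) has_real_derivative - (2 / ln 2 * u\<^sup>2)) (at z)"
    using \<open>z > 0\<close> unfolding u_def
    by (auto intro!: derivative_eq_intros simp: power2_eq_square)
  then have E: "((\<lambda>z. exp (ln 2 / (2 * z + 1))) has_real_derivative - (2 / ln 2 * (u\<^sup>2 * exp u))) (at z)"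
    by (auto dest: DERIV_fun_exp simp: u_def mult_ac)
  have "((\<lambda>z. 3 * z - 1 / (exp (ln 2 / (2 * z + 1)) - 1)) has_real_derivative D) (at z)"
    unfolding D_def
    by (rule derivative_eq_intros E refl)+ (use \<open>exp u > 1\<close> in \<open>auto simp: u_def power2_eq_square\<close>)
  then have "((\<lambda>z. 3 * z - 1 / (2 powr (1 / (2 * z + 1)) - 1)) has_real_derivative D) (at z)"
    by (simp add: powr_def)
  moreover have "D \<ge> 0"
  proof -
    have "u\<^sup>2 * exp u / (exp u - 1)\<^sup>2 \<le> 1"
      using square_times_exp_le[of u] \<open>u > 0\<close> by (simp add: divide_simps)
    then have "2 / ln 2 * (u\<^sup>2 * exp u / (exp u - 1)\<^sup>2) \<le> 2 / ln (2::real) * 1"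
      by (intro mult_left_mono) auto
    also have "\<dots> \<le> 3"
      using ln2_ge_two_thirds by (simp add: field_simps)
    finally show ?thesis by (simp add: D_def)
  qed
  ultimately show "\<exists>D. ((\<lambda>z. 3 * z - 1 / (2 powr (1 / (2 * z + 1)) - 1)) has_real_derivative D) (at z)
      \<and> 0 \<le> D"
    by blast
qed

lemma Omega_mono: "0 < x \<Longrightarrow> x \<le> y \<Longrightarrow> Omega x \<le> Omega y"
  unfolding Omega_def by (intro ceiling_mono Omega_argument_mono)

lemma is_interval_Iset: "is_interval (Iset l)"
  unfolding is_interval_1
proof (intro ballI allI impI)
  fix a b x
  assume ab: "a \<in> Iset l" "b \<in> Iset l" and "a \<le> x \<and> x \<le> b"
  then have "0 < a" "a \<le> x" "x \<le> b" by (auto simp: Iset_def)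
  then have "Omega a \<le> Omega x" "Omega x \<le> Omega b" by (auto intro: Omega_mono)
  with ab \<open>0 < a\<close> \<open>a \<le> x\<close> show "x \<in> Iset l" by (auto simp: Iset_def)
qed

section \<open>Complete monotonicity\<close>

theorem theorem1:
  fixes l :: int
  assumes "l \<ge> 1"
  shows "completely_monotonic_on (Iset l) S_fun \<and>
    (\<forall>x\<in>Iset l. \<forall>n::nat.
       (deriv ^^ n) (f_ell l) field_differentiable (at x) \<and>
       (-1) ^ n * (deriv ^^ n) (f_ell l) x \<ge> 0)"
proof -
  let ?U = "{x. 3 * x - (real_of_int l - 1) > 0}"
  have U: "open ?U" by (intro open_Collect_less continuous_intros)
  note higher = alternating_derivs_higher_deriv[OF U alternating_derivs_f_ell[OF assms]]
  have diff: "(deriv ^^ n) (f_ell l) field_differentiable (at x)" if "x \<in> Iset l" for n x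
    using Iset_subset that by (intro higher(2)) blast
  have sign: "(-1) ^ n * (deriv ^^ n) (f_ell l) x \<ge> 0" if "x \<in> Iset l" for n x
    using Iset_subset that by (intro alternating_derivs_nonneg[OF higher(1)]) blast
  have "((deriv ^^ n) (f_ell l) has_real_derivative (deriv ^^ Suc n) (f_ell l) x) (at x within Iset l)"
    if "x \<in> Iset l" for n x
    using field_differentiable_derivI[OF diff[OF that]]
    by (auto intro: has_field_derivative_at_within)
  moreover have "f_ell l x = S_fun x" if "x \<in> Iset l" for x
    using that by (simp add: Iset_def S_fun_def f_ell_def)
  ultimately have "completely_monotonic_on (Iset l) S_fun"
    unfolding completely_monotonic_on_def using sign is_interval_Iset
    by (intro conjI exI[of _ "\<lambda>n. (deriv ^^ n) (f_ell l)"]) auto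
  with diff sign show ?thesis by blast
qed

end
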